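(* Let $n\ge 1$. Every degenerable formal $n$-cube (with labels in $[n]$) is generated, under gluing and cube morphisms, from the formal cubes $i_\ast C_k$ ($k\ge1$) and $i_\ast D_k$ ($k\ge 0$), where $i\colon[k]\to[n]$ runs over all injections in the simplex category.
   Context: $[m]=\{0<1<\dots<m\}$; $\mathrm{Sub}[m]$ is the set of nonempty subsets of $\{0,\dots,m\}$. A formal $n$-cube with labels in $[m]$ is a map $X\colon\{0,1\}^n\to\mathrm{Sub}[m]$. Points are written $x=(x_0,\dots,x_{n-1})$, with the convention $x_{-1}=1$, $x_n=0$. $X$ is determined by its label functions $f_0,\dots,f_m\colon\{0,1\}^n\to\{0,1\}$, $f_i(x)=1\iff i\in X(x)$; Boolean operations are applied pointwise. Cube morphisms: the category $\square$ has objects $\{0,1\}^n$ and morphisms the maps $\{0,1\}^k\to\{0,1\}^n$ that are restrictions of affine linear maps $\mathbb Z^k\to\mathbb Z^n$; such $\phi$ acts on formal cubes by pullback $X\mapsto X\circ\phi$. A non-decreasing $\psi\colon[m]\to[l]$ acts by pushforward $\psi_\ast X$, taking direct images of labels: $(\psi_\ast X)(x)=\psi(X(x))$. Degenerable: a formal $n$-cube with labels in $[n]$ is degenerable if for every $0\le i<n$, the function $f_i\vee f_{i+1}$, as well as every $f_j$ with $j\notin\{i,i+1\}$, does not depend on $x_i$ (i.e. pushforward along the degeneracy identifying $i$ and $i+1$ is independent of $x_i$). $C_n$ ($n\ge1$) is the formal $n$-cube with labels in $[n]$ and label functions $f_i=x_i\vee\neg x_{i-1}$ for $0\le i\le n$.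 $D_n$ ($n\ge 0$) has label functions $f_i=x_i\vee\neg x_{i-1}$ for $i<n$ and $f_n=1$. Gluing: if formal $n$-cubes $A,B$ with labels in $[m]$ agree on the face $[x_j=\epsilon]$ ($0\le j<n$, $\epsilon\in\{0,1\}$), their gluing $AB$ is the formal $n$-cube whose value at $x$ is $A$ evaluated at $x$ with $x_j$ replaced by $1-\epsilon$ if $x_j=1$, and $B$ evaluated at $x$ with $x_j$ replaced by $1-\epsilon$ if $x_j=0$. "Generated under gluing and cube morphisms from a family" means lying in the smallest class of formal cubes (of all dimensions, labels in $[n]$) that contains the family and is closed under all gluings and all pullbacks along morphisms of $\square$. *)

theory Defs
  imports Main "HOL-Library.FuncSet"
begin

definition points :: "nat \<Rightarrow> bool list set" where
  "points n = {x. length x = n}"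

definition Sub :: "nat \<Rightarrow> nat set set" where
  "Sub m = {S. S \<subseteq> {0..m} \<and> S \<noteq> {}}"

type_synonym fcube = "bool list \<Rightarrow> nat set"

text \<open>Cubes are extensional functions, so that equality of cubes is equality on
  the vertex set.\<close>

definition formal_cubes :: "nat \<Rightarrow> nat \<Rightarrow> fcube set" where
  "formal_cubes n m = points n \<rightarrow>\<^sub>E Sub m"

definition label_fun :: "fcube \<Rightarrow> nat \<Rightarrow> bool list \<Rightarrow> bool" where
  "label_fun X i x \<longleftrightarrow> i \<in> X x"

definition cube_of_labels :: "nat \<Rightarrow> nat \<Rightarrow> (nat \<Rightarrow> bool list \<Rightarrow> bool) \<Rightarrow> fcube" where
  "cube_of_labels n m f = (\<lambda>x\<in>points n. {i. i \<le> m \<and> f i x})"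

text \<open>The integer index accommodates the conventions $x_{-1} = 1$ and $x_n = 0$.\<close>

definition coord :: "bool list \<Rightarrow> int \<Rightarrow> bool" where
  "coord x i = (if i < 0 then True else if i \<ge> int (length x) then False else x ! nat i)"

definition cube_C :: "nat \<Rightarrow> fcube" where
  "cube_C n = cube_of_labels n n (\<lambda>i x. coord x (int i) \<or> \<not> coord x (int i - 1))"

definition cube_D :: "nat \<Rightarrow> fcube" where
  "cube_D n = cube_of_labels n n
     (\<lambda>i x. if i < n then coord x (int i) \<or> \<not> coord x (int i - 1) else True)"

definition cube_mor :: "nat \<Rightarrow> nat \<Rightarrow> (bool list \<Rightarrow> bool list) set" where
  "cube_mor k n = {\<phi> \<in> points k \<rightarrow> points n.
     \<exists>(a :: nat \<Rightarrow> nat \<Rightarrow> int) (b :: nat \<Rightarrow> int). \<forall>x\<in>points k. \<forall>i<n.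
       of_bool (\<phi> x ! i) = b i + (\<Sum>j<k. a i j * of_bool (x ! j))}"

definition pullback :: "nat \<Rightarrow> (bool list \<Rightarrow> bool list) \<Rightarrow> fcube \<Rightarrow> fcube" where
  "pullback k \<phi> X = (\<lambda>x\<in>points k. X (\<phi> x))"

definition pushforward :: "nat \<Rightarrow> (nat \<Rightarrow> nat) \<Rightarrow> fcube \<Rightarrow> fcube" where
  "pushforward n \<psi> X = (\<lambda>x\<in>points n. \<psi> ` X x)"

definition simplex_inj :: "nat \<Rightarrow> nat \<Rightarrow> (nat \<Rightarrow> nat) set" where
  "simplex_inj k n = {\<iota> \<in> {0..k} \<rightarrow> {0..n}. mono_on {0..k} \<iota> \<and> inj_on \<iota> {0..k}}"

definition indep_of :: "nat \<Rightarrow> nat \<Rightarrow> (bool list \<Rightarrow> bool) \<Rightarrow> bool" where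
  "indep_of n i g \<longleftrightarrow> (\<forall>x\<in>points n. g (x[i := True]) = g (x[i := False]))"

definition degenerable :: "nat \<Rightarrow> fcube \<Rightarrow> bool" where
  "degenerable n X \<longleftrightarrow>
     (\<forall>i<n. indep_of n i (\<lambda>x. label_fun X i x \<or> label_fun X (i + 1) x) \<and>
            (\<forall>j\<le>n. j \<notin> {i, i + 1} \<longrightarrow> indep_of n i (label_fun X j)))"

definition agree_on_face :: "nat \<Rightarrow> nat \<Rightarrow> bool \<Rightarrow> fcube \<Rightarrow> fcube \<Rightarrow> bool" where
  "agree_on_face n j \<epsilon> A B \<longleftrightarrow> (\<forall>x\<in>points n. x ! j = \<epsilon> \<longrightarrow> A x = B x)"

definition glue :: "nat \<Rightarrow> nat \<Rightarrow> bool \<Rightarrow> fcube \<Rightarrow> fcube \<Rightarrow> fcube" where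
  "glue n j \<epsilon> A B =
     (\<lambda>x\<in>points n. if x ! j then A (x[j := \<not> \<epsilon>]) else B (x[j := \<not> \<epsilon>]))"

text \<open>A pair \<open>(d, X)\<close> stands for a formal \<open>d\<close>-cube \<open>X\<close>. The label bound is not
  repeated in the closure rules, since gluing and pullback preserve it.\<close>

inductive_set generated :: "(nat \<times> fcube) set \<Rightarrow> (nat \<times> fcube) set"
  for \<G> :: "(nat \<times> fcube) set" where
  base: "(d, X) \<in> \<G> \<Longrightarrow> (d, X) \<in> generated \<G>"
| gluing: "\<lbrakk>(d, A) \<in> generated \<G>; (d, B) \<in> generated \<G>; j < d; agree_on_face d j \<epsilon> A B\<rbrakk>
    \<Longrightarrow> (d, glue d j \<epsilon> A B) \<in> generated \<G>"
| morphism: "\<lbrakk>(d, X) \<in> generated \<G>; \<phi> \<in> cube_mor k d\<rbrakk>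
    \<Longrightarrow> (k, pullback k \<phi> X) \<in> generated \<G>"

definition CD_family :: "nat \<Rightarrow> (nat \<times> fcube) set" where
  "CD_family n =
     {(k, pushforward k \<iota> (cube_C k)) | k \<iota>. k \<ge> 1 \<and> \<iota> \<in> simplex_inj k n} \<union>
     {(k, pushforward k \<iota> (cube_D k)) | k \<iota>. \<iota> \<in> simplex_inj k n}"

end

(*
  Label i of a degenerable cube depends only on x_{i-1} and x_i. Position i is good if
  f_i >= x_i and f_{i+1} >= (not x_i). If all positions are good, the cube is C_n with some labels
  replaced by the constant 1; these arise from C_n and D_n because, among C_n with the label sets
  T, T + i and T + (i+1) replaced by 1, the first and either of the others glue to the third.
  A bad position is removed by gluing two cubes that are good there (if f_i or f_{i+1} is
  constantly 1: subdivide direction i at a point where the other label is 1 as well), by a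
  reflection, or, if neither f_i nor f_{i+1} depends on x_i, by dropping a vanishing label
  (induction on n) after possibly one more subdivision.
*)
theory Submission
  imports Defs
begin

section \<open>Closure of the generated class under gluing, pullback and pushforward\<close>

lemma generated_glueI:
  assumes "(d, A) \<in> generated \<G>" "(d, B) \<in> generated \<G>" "j < d"
    and agree: "\<And>x. x \<in> points d \<Longrightarrow> x ! j = \<epsilon> \<Longrightarrow> A x = B x"
    and "X \<in> extensional (points d)"
    and X: "\<And>x. x \<in> points d \<Longrightarrow> X x = (if x ! j then A (x[j := \<not> \<epsilon>]) else B (x[j := \<not> \<epsilon>]))"
  shows "(d, X) \<in> generated \<G>"
proof -
  have "X = glue d j \<epsilon> A B"
    by (rule extensionalityI[OF assms(5)]) (auto simp: glue_def X)
  moreover have "(d, glue d j \<epsilon> A B) \<in> generated \<G>"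
    using assms(1-3) agree by (intro generated.gluing) (auto simp: agree_on_face_def)
  ultimately show ?thesis by simp
qed

text \<open>A coordinate or its negation is x_m or 1 - x_m, hence affine. The reflections, diagonals
  and coordinate omissions below are all of this form.\<close>

lemma cube_morI:
  assumes len: "\<And>x. x \<in> points k \<Longrightarrow> \<phi> x \<in> points n"
    and lit: "\<And>j. j < n \<Longrightarrow> \<exists>m<k. \<exists>b. \<forall>x\<in>points k. \<phi> x ! j = (x ! m = b)"
  shows "\<phi> \<in> cube_mor k n"
proof -
  obtain m b where mb: "\<And>j. j < n \<Longrightarrow> m j < k"
    "\<And>j x. j < n \<Longrightarrow> x \<in> points k \<Longrightarrow> \<phi> x ! j = (x ! m j = b j)"
    using lit by metis
  define a :: "nat \<Rightarrow> nat \<Rightarrow> int" where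
    "a i l = (if l = m i then if b i then 1 else - 1 else 0)" for i l
  define c :: "nat \<Rightarrow> int" where "c i = (if b i then 0 else 1)" for i
  have "of_bool (\<phi> x ! i) = c i + (\<Sum>j<k. a i j * of_bool (x ! j))"
    if "x \<in> points k" "i < n" for x i
  proof -
    have "(\<Sum>j<k. a i j * of_bool (x ! j))
        = (\<Sum>j<k. if j = m i then (if b i then 1 else - 1) * of_bool (x ! j) else 0)"
      by (rule sum.cong) (auto simp: a_def)
    also have "\<dots> = (if b i then 1 else - 1) * of_bool (x ! m i)"
      using mb(1)[OF that(2)] by simp
    finally show ?thesis using mb(2)[OF that(2,1)] by (simp add: c_def)
  qed
  then show ?thesis using len unfolding cube_mor_def by blast
qed

lemma generated_pullbackI:
  assumes "(d, Y) \<in> generated \<G>"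
    and "\<And>x. x \<in> points k \<Longrightarrow> \<phi> x \<in> points d"
    and "\<And>j. j < d \<Longrightarrow> \<exists>m<k. \<exists>b. \<forall>x\<in>points k. \<phi> x ! j = (x ! m = b)"
    and "X \<in> extensional (points k)"
    and X: "\<And>x. x \<in> points k \<Longrightarrow> X x = Y (\<phi> x)"
  shows "(k, X) \<in> generated \<G>"
proof -
  have "X = pullback k \<phi> Y"
    by (rule extensionalityI[OF assms(4)]) (auto simp: pullback_def X)
  then show ?thesis using generated.morphism[OF assms(1) cube_morI[OF assms(2,3)]] by simp
qed

lemma simplex_inj_comp:
  assumes "\<iota> \<in> simplex_inj k m" "\<psi> \<in> simplex_inj m n"
  shows "\<psi> \<circ> \<iota> \<in> simplex_inj k n"
proof -
  have im: "\<iota> ` {0..k} \<subseteq> {0..m}" using assms(1) by (auto simp: simplex_inj_def)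
  have "inj_on (\<psi> \<circ> \<iota>) {0..k}"
    using assms by (intro comp_inj_on inj_on_subset[OF _ im]) (auto simp: simplex_inj_def)
  moreover have "mono_on {0..k} (\<psi> \<circ> \<iota>)"
  proof (rule monotone_onI)
    fix i j assume "i \<in> {0..k}" "j \<in> {0..k}" "i \<le> j"
    then show "(\<psi> \<circ> \<iota>) i \<le> (\<psi> \<circ> \<iota>) j"
      using assms im by (simp add: simplex_inj_def monotone_on_def image_subset_iff)
  qed
  moreover have "\<psi> \<circ> \<iota> \<in> {0..k} \<rightarrow> {0..n}"
    using assms im by (auto simp: simplex_inj_def Pi_iff image_subset_iff)
  ultimately show ?thesis by (simp add: simplex_inj_def)
qed

lemma pushforward_pushforward:
  "pushforward d \<psi> (pushforward d \<iota> X) = pushforward d (\<psi> \<circ> \<iota>) X"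
  unfolding pushforward_def by (rule restrict_ext) (simp add: image_comp)

lemma pushforward_id:
  assumes "X \<in> extensional (points d)" shows "pushforward d (\<lambda>i. i) X = X"
  by (rule extensionalityI[OF _ assms]) (auto simp: pushforward_def)

text \<open>Injections compose, and pushforward commutes with gluing and with pullback. This
  transports cubes obtained in lower dimension into the larger label set.\<close>

lemma generated_pushforward:
  assumes "(d, Y) \<in> generated (CD_family m)" "\<psi> \<in> simplex_inj m n"
  shows "(d, pushforward d \<psi> Y) \<in> generated (CD_family n)"
  using assms(1)
proof (induction d Y rule: generated.induct)
  case (base d X)
  then have "(d, pushforward d \<psi> X) \<in> CD_family n"
    unfolding CD_family_def using assms(2)
    by (auto simp: pushforward_pushforward intro: simplex_inj_comp)
  then show ?case by (rule generated.base)
next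
  case (gluing d A B j \<epsilon>)
  show ?case
    by (rule generated_glueI[OF gluing.IH gluing.hyps(3), of \<epsilon>])
      (use gluing.hyps(3,4) in \<open>auto simp: extensional_def agree_on_face_def pushforward_def glue_def points_def\<close>)
next
  case (morphism d X \<phi> k)
  have "\<phi> x \<in> points d" if "x \<in> points k" for x
    using morphism(2) that by (auto simp: cube_mor_def)
  then have "pushforward k \<psi> (pullback k \<phi> X) = pullback k \<phi> (pushforward d \<psi> X)"
    by (auto simp: pushforward_def pullback_def intro!: restrict_ext)
  then show ?case using generated.morphism[OF morphism.IH morphism.hyps(2)] by simp
qed

section \<open>Local description of degenerable cubes\<close>

text \<open>The \<open>i\<close>-th label of a degenerable cube depends only on $x_{i-1}$ and $x_i$; \<open>g i\<close> is
  that dependence, with $x_{-1} = 1$ and $x_n = 0$ as before.\<close>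

definition local_cube :: "nat \<Rightarrow> (nat \<Rightarrow> bool \<Rightarrow> bool \<Rightarrow> bool) \<Rightarrow> fcube" where
  "local_cube n g = (\<lambda>x\<in>points n. {i. i \<le> n \<and> g i (i = 0 \<or> x ! (i - 1)) (i < n \<and> x ! i)})"

text \<open>With the conventions for $x_{-1}$ and $x_n$ these are the labels of $C_n$, with those
  in \<open>S\<close> replaced by 1; \<open>S = {n}\<close> gives $D_n$.\<close>

definition cornered :: "nat set \<Rightarrow> nat \<Rightarrow> bool \<Rightarrow> bool \<Rightarrow> bool" where
  "cornered S i a c \<longleftrightarrow> c \<or> \<not> a \<or> i \<in> S"

text \<open>Nonemptiness at one point suffices, since the disjunction of all labels of a
  degenerable cube is constant.\<close>

definition local_degenerable :: "nat \<Rightarrow> (nat \<Rightarrow> bool \<Rightarrow> bool \<Rightarrow> bool) \<Rightarrow> bool" where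
  "local_degenerable n g \<longleftrightarrow>
     (\<forall>a b c. g 0 a c = g 0 b c) \<and> (\<forall>a b c. g n a b = g n a c) \<and>
     (\<forall>i<n. \<forall>a c. (g i a False \<or> g (Suc i) False c) = (g i a True \<or> g (Suc i) True c)) \<and>
     (\<exists>i\<le>n. \<exists>a c. g i a c)"

definition good_at :: "(nat \<Rightarrow> bool \<Rightarrow> bool \<Rightarrow> bool) \<Rightarrow> nat \<Rightarrow> bool" where
  "good_at g i \<longleftrightarrow> (\<forall>a. g i a True) \<and> (\<forall>c. g (Suc i) False c)"

lemma local_cube_ext [simp]: "local_cube n g \<in> extensional (points n)"
  by (simp add: local_cube_def)

lemma zero_in_local_cube [simp]:
  "x \<in> points n \<Longrightarrow> 0 \<in> local_cube n g x \<longleftrightarrow> g 0 True (0 < n \<and> x ! 0)"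
  by (simp add: local_cube_def)

lemma Suc_in_local_cube [simp]:
  "x \<in> points n \<Longrightarrow>
     Suc k \<in> local_cube n g x \<longleftrightarrow> k < n \<and> g (Suc k) (x ! k) (Suc k < n \<and> x ! Suc k)"
  by (auto simp: local_cube_def)

text \<open>The split matches the membership rules for label 0 and for successor labels, which keeps
  \<open>i - 1\<close> out of the goals.\<close>

lemma nat_set_eqI:
  fixes A B :: "nat set"
  assumes "0 \<in> A \<longleftrightarrow> 0 \<in> B" "\<And>k. Suc k \<in> A \<longleftrightarrow> Suc k \<in> B"
  shows "A = B"
  using assms by (metis not0_implies_Suc set_eqI)

lemma list_update_points [simp]: "x \<in> points n \<Longrightarrow> x[i := b] \<in> points n"
  by (simp add: points_def)

lemma nth_list_update_points [simp]:
  "x \<in> points n \<Longrightarrow> i < n \<Longrightarrow> x[i := b] ! k = (if k = i then b else x ! k)"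
  by (simp add: points_def nth_list_update)

lemma local_cube_cong:
  assumes "\<And>i a c. i \<le> n \<Longrightarrow> (i = 0 \<Longrightarrow> a) \<Longrightarrow> (i = n \<Longrightarrow> \<not> c) \<Longrightarrow> g i a c = h i a c"
  shows "local_cube n g = local_cube n h"
  unfolding local_cube_def using assms by (intro restrict_ext Collect_cong) auto

section \<open>Cubes with only good positions\<close>

lemma simplex_inj_id: "(\<lambda>i. i) \<in> simplex_inj n n"
  by (auto simp: simplex_inj_def mono_on_def)

lemma local_cube_cornered_empty: "local_cube n (cornered {}) = cube_C n"
  unfolding local_cube_def cube_C_def cube_of_labels_def
  by (intro restrict_ext Collect_cong conj_cong)
    (auto simp: coord_def cornered_def points_def nat_diff_distrib)

lemma local_cube_cornered_top: "local_cube n (cornered {n}) = cube_D n"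
  unfolding local_cube_def cube_D_def cube_of_labels_def
  by (intro restrict_ext Collect_cong conj_cong)
    (auto simp: coord_def cornered_def points_def nat_diff_distrib)

lemma generated_C:
  assumes "n \<ge> 1" shows "(n, local_cube n (cornered {})) \<in> generated (CD_family n)"
proof -
  have "pushforward n (\<lambda>i. i) (cube_C n) = cube_C n"
    by (rule pushforward_id) (simp add: cube_C_def cube_of_labels_def)
  then show ?thesis unfolding local_cube_cornered_empty
    using assms simplex_inj_id by (intro generated.base) (force simp: CD_family_def)
qed

lemma generated_D: "(n, local_cube n (cornered {n})) \<in> generated (CD_family n)"
proof -
  have "pushforward n (\<lambda>i. i) (cube_D n) = cube_D n"
    by (rule pushforward_id) (simp add: cube_D_def cube_of_labels_def)
  then show ?thesis unfolding local_cube_cornered_top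
    using simplex_inj_id by (intro generated.base) (force simp: CD_family_def)
qed

text \<open>The factors can differ only in label i + 1, which is 1 on both where x_i = 0. The outer
  faces both come from x_i = 1, so label i of the gluing is 1; the second factor also has label i +
  1 equal to 1 there, as is required at x_i = 0.\<close>

lemma cornered_down:
  assumes "(n, local_cube n (cornered T)) \<in> generated \<G>"
    and "(n, local_cube n (cornered (insert (Suc i) T))) \<in> generated \<G>" and "i < n"
  shows "(n, local_cube n (cornered (insert i T))) \<in> generated \<G>"
  by (rule generated_glueI[OF assms, where \<epsilon> = False])
    (use \<open>i < n\<close> in \<open>auto simp: cornered_def split: if_splits intro!: nat_set_eqI\<close>)

text \<open>Mirror image of \<open>cornered_down\<close>: the common face is x_i = 1, where label i
  is 1 anyway, and the outer faces come from x_i = 0.\<close>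

lemma cornered_up:
  assumes "(n, local_cube n (cornered (insert i T))) \<in> generated \<G>"
    and "(n, local_cube n (cornered T)) \<in> generated \<G>" and "i < n"
  shows "(n, local_cube n (cornered (insert (Suc i) T))) \<in> generated \<G>"
  by (rule generated_glueI[OF assms, where \<epsilon> = True])
    (use \<open>i < n\<close> in \<open>auto simp: cornered_def split: if_splits intro!: nat_set_eqI\<close>)

text \<open>The additional full label walks from \<open>t\<close> to \<open>j\<close> one position
  at a time, leftwards by \<open>cornered_down\<close> and rightwards by
  \<open>cornered_up\<close>.\<close>

lemma cornered_insert:
  assumes T: "(n, local_cube n (cornered T)) \<in> generated \<G>"
    and t: "(n, local_cube n (cornered (insert t T))) \<in> generated \<G>"
    and "t \<le> n" "j \<le> n"
  shows "(n, local_cube n (cornered (insert j T))) \<in> generated \<G>"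
proof (cases "j \<le> t")
  case True
  then show ?thesis
  proof (induction rule: inc_induct)
    case (step i)
    then show ?case using cornered_down[OF T] \<open>t \<le> n\<close> by simp
  qed (fact t)
next
  case False
  then have "t \<le> j" by simp
  then show ?thesis using \<open>j \<le> n\<close>
  proof (induction rule: dec_induct)
    case (step i)
    then show ?case using cornered_up[OF _ T] by simp
  qed (simp add: t)
qed

lemma generated_cornered:
  assumes "n \<ge> 1" "S \<subseteq> {..n}"
  shows "(n, local_cube n (cornered S)) \<in> generated (CD_family n)"
  using finite_subset[OF assms(2) finite_atMost] assms(2)
proof (induction S rule: finite_induct)
  case empty
  show ?case using assms(1) by (rule generated_C)
next
  case (insert j T)
  have T: "(n, local_cube n (cornered T)) \<in> generated (CD_family n)" using insert by simp
  \<comment> \<open>A starting point for the walk: D_n supplies \<open>t = n\<close> if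
    \<open>T\<close> is empty, and otherwise any \<open>t\<close> in \<open>T\<close> serves, since
    inserting it changes nothing.\<close>
  have "\<exists>t\<le>n. (n, local_cube n (cornered (insert t T))) \<in> generated (CD_family n)"
  proof (cases "T = {}")
    case True
    then show ?thesis using generated_D by blast
  next
    case False
    then obtain t where "t \<in> T" by blast
    then show ?thesis using T insert.prems by (intro exI[of _ t]) (auto simp: insert_absorb)
  qed
  then show ?case using insert.prems cornered_insert[OF T] by auto
qed

lemma generated_all_good:
  assumes g: "local_degenerable n g" and good: "\<And>i. i < n \<Longrightarrow> good_at g i"
  shows "(n, local_cube n g) \<in> generated (CD_family n)"
proof (cases "n = 0")
  case True
  obtain a c where "g 0 a c" using g True by (auto simp: local_degenerable_def)
  then have "g 0 b d" for b d using g unfolding True local_degenerable_def by blast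
  \<comment> \<open>In dimension 0 the only label is constant, hence 1 by nonemptiness; the cube is
    D_0.\<close>
  then have "local_cube n g = local_cube n (cornered {n})"
    using True by (intro local_cube_cong) (auto simp: cornered_def)
  then show ?thesis using generated_D by simp
next
  case False
  \<comment> \<open>Goodness on both sides forces the value 1 except at x_{i-1} = 1, x_i = 0; the
    value there decides whether the label is full.\<close>
  have "g i a c = cornered {i. i \<le> n \<and> g i True False} i a c"
    if "i \<le> n" "i = 0 \<Longrightarrow> a" "i = n \<Longrightarrow> \<not> c" for i a c
  proof -
    have "g i a True" if "i < n" for a using good[OF that] by (simp add: good_at_def)
    moreover have "g i False c" if "i > 0" for c
      using good[of "i - 1"] that \<open>i \<le> n\<close> by (simp add: good_at_def)
    ultimately show ?thesis
      using that by (cases "i = n"; cases a; cases c) (auto simp: cornered_def)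
  qed
  then have "local_cube n g = local_cube n (cornered {i. i \<le> n \<and> g i True False})"
    by (rule local_cube_cong)
  then show ?thesis using generated_cornered[of n "{i. i \<le> n \<and> g i True False}"] False by auto
qed

section \<open>Case distinction at one position and removal of bad positions\<close>

text \<open>If \<open>p a False\<close> holds and \<open>p a True\<close> fails for some
  \<open>a\<close>, then \<open>q True\<close> is identically true, and so are both sides of the
  equation. Hence \<open>p _ False\<close> or \<open>q False _\<close> is identically true, which is
  the third or the second case. Other dependences are symmetric; without any, the last case
  holds.\<close>

lemma local_degenerable_cases:
  fixes p q :: "bool \<Rightarrow> bool \<Rightarrow> bool"
  assumes "\<And>a c. (p a False \<or> q False c) = (p a True \<or> q True c)"
  obtains "\<forall>a c. p a c" | "\<forall>a c. q a c"
    | "\<forall>a. p a False" "\<forall>c. q True c"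
    | "\<forall>a. p a True" "\<forall>c. q False c"
    | "\<forall>a b c. p a b = p a c" "\<forall>a b c. q a c = q b c"
proof -
  have "(\<forall>a c. p a c) \<or> (\<forall>a c. q a c) \<or> (\<forall>a. p a False) \<and> (\<forall>c. q True c) \<or>
      (\<forall>a. p a True) \<and> (\<forall>c. q False c) \<or>
      (\<forall>a b c. p a b = p a c) \<and> (\<forall>a b c. q a c = q b c)"
    using assms[of True True] assms[of True False] assms[of False True] assms[of False False]
    unfolding all_bool_eq by argo
  then show ?thesis using that by argo
qed

definition bad_count :: "nat \<Rightarrow> (nat \<Rightarrow> bool \<Rightarrow> bool \<Rightarrow> bool) \<Rightarrow> nat" where
  "bad_count n g = card {i. i < n \<and> \<not> good_at g i}"

lemma bad_count_less:
  assumes "i < n" "\<not> good_at g i" "good_at h i" "\<And>j. j < n \<Longrightarrow> good_at g j \<Longrightarrow> good_at h j"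
  shows "bad_count n h < bad_count n g"
  unfolding bad_count_def using assms by (intro psubset_card_mono) auto

text \<open>Pushforward along the injection missing \<open>l\<close>, then pullback along the map
  omitting coordinate \<open>l\<close> (the last one if \<open>l = Suc n\<close>) and negating those
  with \<open>b j\<close> false.\<close>

lemma generated_drop_label:
  assumes h: "(n, local_cube n h) \<in> generated (CD_family n)" and l: "l \<le> Suc n"
    and "X \<in> extensional (points (Suc n))"
    and X: "\<And>x. x \<in> points (Suc n) \<Longrightarrow> X x =
      (\<lambda>i. if i < l then i else Suc i) `
        local_cube n h (map (\<lambda>j. x ! (if j < l then j else Suc j) = b j) [0..<n])"
  shows "(Suc n, X) \<in> generated (CD_family (Suc n))"
proof -
  let ?s = "\<lambda>i. if i < l then i else Suc i"
  have "?s \<in> simplex_inj n (Suc n)"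
    by (auto simp: simplex_inj_def mono_on_def inj_on_def)
  from generated_pushforward[OF h this]
  show ?thesis
  proof (rule generated_pullbackI[where \<phi> =
        "\<lambda>x. map (\<lambda>j. x ! (if j < l then j else Suc j) = b j) [0..<n]"], goal_cases)
    case (2 j)
    then show ?case by (intro exI[of _ "?s j"] conjI exI[of _ "b j"]) auto
  next
    case (4 x)
    then show ?case by (simp add: X pushforward_def points_def)
  qed (use assms(3) in \<open>auto simp: points_def\<close>)
qed

lemma local_degenerable_first: "local_degenerable n g \<Longrightarrow> g 0 a c = g 0 b c"
  unfolding local_degenerable_def by blast

lemma local_degenerable_last: "local_degenerable n g \<Longrightarrow> g n a b = g n a c"
  unfolding local_degenerable_def by blast

lemma local_degenerable_step:
  "local_degenerable n g \<Longrightarrow> i < n \<Longrightarrow>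
     (g i a False \<or> g (Suc i) False c) = (g i a True \<or> g (Suc i) True c)"
  unfolding local_degenerable_def by blast

lemma local_degenerable_nonempty:
  assumes "local_degenerable n g" obtains i a c where "i \<le> n" "g i a c"
  using assms unfolding local_degenerable_def by blast

lemma local_degenerableI:
  assumes "\<And>a b c. g 0 a c = g 0 b c" "\<And>a b c. g n a b = g n a c"
    and "\<And>i a c. i < n \<Longrightarrow>
      (g i a False \<or> g (Suc i) False c) = (g i a True \<or> g (Suc i) True c)"
    and "i \<le> n" "g i a c"
  shows "local_degenerable n g"
  using assms unfolding local_degenerable_def by blast

context
  fixes n :: nat and g :: "nat \<Rightarrow> bool \<Rightarrow> bool \<Rightarrow> bool"
  assumes g: "local_degenerable n g"
    and IH: "\<And>h. local_degenerable n h \<Longrightarrow> bad_count n h < bad_count n g \<Longrightarrow>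
      (n, local_cube n h) \<in> generated (CD_family n)"
begin

text \<open>Direction i is subdivided at a point where label i + 1 is 1. The half
  \<open>h \<epsilon>\<close> has this point at x_i = 0 and the face x_i = \<open>\<epsilon>\<close>
  of the given cube at x_i = 1. Freezing x_i in label i + 1 preserves degenerability at position i +
  1, where the condition holds for either value of x_i.\<close>

lemma generated_left_full:
  assumes i: "i < n" "\<not> good_at g i" and full: "\<And>a c. g i a c"
  shows "(n, local_cube n g) \<in> generated (CD_family n)"
proof -
  define h where "h \<epsilon> = g(Suc i := \<lambda>a c. g (Suc i) \<epsilon> c \<or> \<not> a)" for \<epsilon>
  have gen: "(n, local_cube n (h \<epsilon>)) \<in> generated (CD_family n)" for \<epsilon>
  proof (rule IH)
    show "local_degenerable n (h \<epsilon>)"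
    proof (rule local_degenerableI)
      show "h \<epsilon> 0 a c = h \<epsilon> 0 b c" for a b c
        using local_degenerable_first[OF g] by (simp add: h_def)
      show "h \<epsilon> n a b = h \<epsilon> n a c" for a b c
        using local_degenerable_last[OF g] by (auto simp: h_def)
      show "(h \<epsilon> j a False \<or> h \<epsilon> (Suc j) False c) = (h \<epsilon> j a True \<or> h \<epsilon> (Suc j) True c)"
        if "j < n" for j a c
        using local_degenerable_step[OF g that, of a c] local_degenerable_step[OF g that, of \<epsilon> c] full
        by (auto simp: h_def)
      show "i \<le> n" "h \<epsilon> i True True" using i full by (auto simp: h_def)
    qed
    show "bad_count n (h \<epsilon>) < bad_count n g"
      by (rule bad_count_less[OF i]) (auto simp: good_at_def h_def full)
  qed
  show ?thesis
    by (rule generated_glueI[OF gen[of True] gen[of False] i(1), where \<epsilon> = False])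
      (use i full in \<open>auto simp: h_def split: if_splits intro!: nat_set_eqI\<close>)
qed

text \<open>Mirror image of \<open>generated_left_full\<close>: label i is frozen instead, and the
  subdivision point sits at x_i = 1.\<close>

lemma generated_right_full:
  assumes i: "i < n" "\<not> good_at g i" and full: "\<And>a c. g (Suc i) a c"
  shows "(n, local_cube n g) \<in> generated (CD_family n)"
proof -
  define h where "h \<epsilon> = g(i := \<lambda>a c. g i a \<epsilon> \<or> c)" for \<epsilon>
  have gen: "(n, local_cube n (h \<epsilon>)) \<in> generated (CD_family n)" for \<epsilon>
  proof (rule IH)
    show "local_degenerable n (h \<epsilon>)"
    proof (rule local_degenerableI)
      show "h \<epsilon> 0 a c = h \<epsilon> 0 b c" for a b c
        using local_degenerable_first[OF g] by (auto simp: h_def)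
      show "h \<epsilon> n a b = h \<epsilon> n a c" for a b c
        using local_degenerable_last[OF g] i by (simp add: h_def)
      show "(h \<epsilon> j a False \<or> h \<epsilon> (Suc j) False c) = (h \<epsilon> j a True \<or> h \<epsilon> (Suc j) True c)"
        if "j < n" for j a c
        using local_degenerable_step[OF g that, of a c] local_degenerable_step[OF g that, of a \<epsilon>] full
        by (auto simp: h_def)
      show "Suc i \<le> n" "h \<epsilon> (Suc i) True True" using i full by (auto simp: h_def)
    qed
    show "bad_count n (h \<epsilon>) < bad_count n g"
      by (rule bad_count_less[OF i]) (auto simp: good_at_def h_def full)
  qed
  show ?thesis
    by (rule generated_glueI[OF gen[of True] gen[of False] i(1), where \<epsilon> = True])
      (use i full in \<open>auto simp: h_def split: if_splits intro!: nat_set_eqI\<close>)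
qed

lemma generated_reversed:
  assumes i: "i < n" "\<not> good_at g i" and rev: "\<And>a. g i a False" "\<And>c. g (Suc i) True c"
  shows "(n, local_cube n g) \<in> generated (CD_family n)"
proof -
  define h where "h = g(i := \<lambda>a c. g i a (\<not> c), Suc i := \<lambda>a c. g (Suc i) (\<not> a) c)"
  have "(n, local_cube n h) \<in> generated (CD_family n)"
  proof (rule IH)
    show "local_degenerable n h"
    proof (rule local_degenerableI)
      show "h 0 a c = h 0 b c" for a b c
        using local_degenerable_first[OF g] by (auto simp: h_def)
      show "h n a b = h n a c" for a b c
        using local_degenerable_last[OF g] i by (auto simp: h_def)
      show "(h j a False \<or> h (Suc j) False c) = (h j a True \<or> h (Suc j) True c)"
        if "j < n" for j a c
        using local_degenerable_step[OF g that, of a c] local_degenerable_step[OF g that, of "\<not> a" c]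
          local_degenerable_step[OF g that, of a "\<not> c"] rev
        by (auto simp: h_def)
      show "i \<le> n" "h i True True" using i rev by (auto simp: h_def)
    qed
    show "bad_count n h < bad_count n g"
      by (rule bad_count_less[OF i]) (auto simp: good_at_def h_def rev)
  qed
  then show ?thesis
  proof (rule generated_pullbackI[where \<phi> = "\<lambda>x. x[i := \<not> x ! i]"], goal_cases)
    case (2 j)
    then show ?case by (intro exI[of _ j] conjI exI[of _ "j \<noteq> i"]) (auto simp: i)
  qed (use i in \<open>auto simp: h_def split: if_splits intro!: nat_set_eqI\<close>)
qed

end

section \<open>Vanishing labels\<close>

lemma mem_skip_image:
  "i \<in> (\<lambda>i. if i < l then i else Suc i) ` A \<longleftrightarrow> (if i < l then i \<in> A else i \<noteq> l \<and> i - 1 \<in> A)"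
  (is "?L = ?R")
proof
  assume ?R
  then show ?L
    by (cases "i < l") (auto intro!: image_eqI[of _ _ i] image_eqI[of _ _ "i - 1"])
qed (auto split: if_splits)

lemma mem_local_cube:
  "x \<in> points n \<Longrightarrow>
     i \<in> local_cube n g x \<longleftrightarrow> i \<le> n \<and> g i (i = 0 \<or> x ! (i - 1)) (i < n \<and> x ! i)"
  by (simp add: local_cube_def)

text \<open>If label l vanishes, degenerability at positions l - 1 and l makes label l - 1
  independent of x_{l-1} and label l + 1 independent of x_l. Omitting label l and one coordinate
  therefore loses nothing, and the smaller cube is idle where the two neighbours meet.\<close>

lemma generated_zero_label:
  assumes IH: "\<And>h. local_degenerable n h \<Longrightarrow> (n, local_cube n h) \<in> generated (CD_family n)"
    and g: "local_degenerable (Suc n) g" and l: "l \<le> Suc n" and zero: "\<And>a c. \<not> g l a c"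
  shows "(Suc n, local_cube (Suc n) g) \<in> generated (CD_family (Suc n))"
proof -
  define h where "h i = (if i < l then g i else g (Suc i))" for i
  have left: "g k a b = g k a c" if "Suc k = l" for k a b c
  proof -
    have "g k a False = g k a True"
      using local_degenerable_step[OF g, of k a True] zero that l by simp
    then show ?thesis by (cases b; cases c) auto
  qed
  have right: "g (Suc l) a c = g (Suc l) b c" if "l < Suc n" for a b c
  proof -
    have "g (Suc l) False c = g (Suc l) True c"
      using local_degenerable_step[OF g that, of True c] zero by simp
    then show ?thesis by (cases a; cases b) auto
  qed
  have "local_degenerable n h"
  proof -
    obtain i a c where i: "i \<le> Suc n" "g i a c" using local_degenerable_nonempty[OF g] .
    then have "i \<noteq> l" using zero by metis
    show ?thesis
    proof (rule local_degenerableI)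
      show "h 0 a c = h 0 b c" for a b c
        using local_degenerable_first[OF g, of a c b] right[of a c b] by (auto simp: h_def)
      show "h n a b = h n a c" for a b c
        using local_degenerable_last[OF g, of a b c] left[of n a b c] l
        by (cases "l = Suc n") (auto simp: h_def)
      show "(h j a False \<or> h (Suc j) False c) = (h j a True \<or> h (Suc j) True c)"
        if "j < n" for j a c
      proof -
        consider "Suc j < l" | "Suc j = l" | "l \<le> j" by linarith
        then show ?thesis
        proof cases
          case 1
          then show ?thesis using local_degenerable_step[OF g, of j a c] that by (simp add: h_def)
        next
          case 2
          then show ?thesis
            using left[of j a False True] right[of False c True] that by (auto simp: h_def)
        next
          case 3
          then show ?thesis
            using local_degenerable_step[OF g, of "Suc j" a c] that by (simp add: h_def)
        qed
      qed
      show "(if i < l then i else i - 1) \<le> n" using i \<open>i \<noteq> l\<close> l by auto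
      show "h (if i < l then i else i - 1) a c" using i \<open>i \<noteq> l\<close> by (auto simp: h_def)
    qed
  qed
  from IH[OF this] show ?thesis
  proof (rule generated_drop_label[where b = "\<lambda>_. True", OF _ l local_cube_ext])
    fix x :: "bool list"
    assume x: "x \<in> points (Suc n)"
    define y where "y = map (\<lambda>j. x ! (if j < l then j else Suc j) = True) [0..<n]"
    have y: "y \<in> points n" by (simp add: y_def points_def)
    have y_nth: "y ! j = x ! (if j < l then j else Suc j)" if "j < n" for j
      using that by (simp add: y_def)
    have below: "i \<in> local_cube (Suc n) g x \<longleftrightarrow> i \<in> local_cube n h y" if "i < l" for i
    proof -
      have "i \<le> n" using that l by simp
      \<comment> \<open>The case \<open>i = n\<close> occurs only for \<open>l = Suc n\<close>; the
        omitted coordinate is then x_n, which label n ignores.\<close>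
      have "g i a (x ! i) = g i a (i < n \<and> y ! i)" for a
      proof (cases "i = n")
        case True
        then show ?thesis using left[of i a "x ! i" False] l that by simp
      qed (use \<open>i \<le> n\<close> that in \<open>simp add: y_nth\<close>)
      moreover have "(i = 0 \<or> x ! (i - 1)) = (i = 0 \<or> y ! (i - 1))"
        using \<open>i \<le> n\<close> that by (cases i) (simp_all add: y_nth)
      ultimately show ?thesis
        unfolding mem_local_cube[OF x] mem_local_cube[OF y] using that \<open>i \<le> n\<close>
        by (simp add: h_def)
    qed
    have above: "Suc k \<in> local_cube (Suc n) g x \<longleftrightarrow> k \<in> local_cube n h y" if "l \<le> k" for k
    proof (cases "k \<le> n")
      case True
      \<comment> \<open>For \<open>k = l\<close> the left neighbour changes from x_l to x_{l-1}, but
        label l + 1 ignores it.\<close>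
      have "g (Suc k) (x ! k) c = g (Suc k) (k = 0 \<or> y ! (k - 1)) c" for c
      proof (cases "l = k")
        case True
        then show ?thesis using right[of "x ! k" c "k = 0 \<or> y ! (k - 1)"] \<open>k \<le> n\<close> by simp
      next
        case False
        then show ?thesis using that \<open>k \<le> n\<close> by (cases k) (simp_all add: y_nth)
      qed
      moreover have "(Suc k < Suc n \<and> x ! Suc k) = (k < n \<and> y ! k)"
        using that by (auto simp: y_nth)
      ultimately show ?thesis
        unfolding mem_local_cube[OF x] mem_local_cube[OF y] using that True
        by (simp add: h_def)
    qed (simp add: mem_local_cube[OF x] mem_local_cube[OF y])
    have "i \<in> local_cube (Suc n) g x \<longleftrightarrow>
        i \<in> (\<lambda>i. if i < l then i else Suc i) ` local_cube n h y" for i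
    proof (cases i l rule: linorder_cases)
      case less
      then show ?thesis using below by (simp only: mem_skip_image if_True)
    next
      case equal
      then show ?thesis using zero by (auto simp: mem_local_cube[OF x])
    next
      case greater
      then show ?thesis unfolding mem_skip_image using above[of "i - 1"] by simp
    qed
    then show "local_cube (Suc n) g x = (\<lambda>i. if i < l then i else Suc i) `
        local_cube n h (map (\<lambda>j. x ! (if j < l then j else Suc j) = True) [0..<n])"
      unfolding y_def by blast
  qed
qed

section \<open>Two labels separated by an idle coordinate\<close>

text \<open>In the remaining case label \<open>i = k + 1\<close> is $\neg x_{i-1}$ and label \<open>i + 1\<close> is
  $x_{i+1}$, and $x_i$ is idle. Subdivide direction $x_{i-1}$ at a point where label \<open>i\<close> is 0 and
  label \<open>i + 1\<close> is 1. On one half $x_i = \neg x_{i-1}$ embeds into a cube where position \<open>i\<close> is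
  good; on the other half label \<open>i\<close> vanishes, so that $x_{i-1}$ and $x_{i+1}$ become adjacent.\<close>

lemma generated_separated:
  assumes IHm: "\<And>h. local_degenerable m h \<Longrightarrow> (m, local_cube m h) \<in> generated (CD_family m)"
    and IH: "\<And>h. local_degenerable (Suc m) h \<Longrightarrow> bad_count (Suc m) h < bad_count (Suc m) g \<Longrightarrow>
      (Suc m, local_cube (Suc m) h) \<in> generated (CD_family (Suc m))"
    and g: "local_degenerable (Suc m) g"
    and k: "Suc k < m"
    and gk: "\<And>a. g k a True"
    and g1: "\<And>a c. g (Suc k) a c = (\<not> a)"
    and g2: "\<And>a c. g (Suc (Suc k)) a c = c"
    and g3: "\<And>c. g (Suc (Suc (Suc k))) False c"
  shows "(Suc m, local_cube (Suc m) g) \<in> generated (CD_family (Suc m))"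
proof -
  let ?n = "Suc m"
  define h where "h = g(Suc k := \<lambda>a c. c \<or> \<not> a, Suc (Suc k) := \<lambda>a c. c \<or> \<not> a)"
  have "local_degenerable ?n h"
  proof (rule local_degenerableI)
    show "h 0 a c = h 0 b c" for a b c
      using local_degenerable_first[OF g] by (simp add: h_def)
    show "h ?n a b = h ?n a c" for a b c
      using local_degenerable_last[OF g] k by (simp add: h_def)
    show "(h j a False \<or> h (Suc j) False c) = (h j a True \<or> h (Suc j) True c)"
      if "j < ?n" for j a c
      using local_degenerable_step[OF g that, of a c] gk g3 by (auto simp: h_def)
    show "Suc k \<le> ?n" "h (Suc k) True True" using k by (auto simp: h_def)
  qed
  moreover have "bad_count ?n h < bad_count ?n g"
    by (rule bad_count_less[of "Suc k"]) (use k in \<open>auto simp: good_at_def h_def g2\<close>)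
  ultimately have h: "(?n, local_cube ?n h) \<in> generated (CD_family ?n)" by (rule IH)
  \<comment> \<open>Substituting x_{k+1} = (not x_k) into \<open>h\<close> turns label k + 1 into
    (not x_k) and label k + 2 into (x_{k+2} or x_k).\<close>
  define A where "A = (\<lambda>x\<in>points ?n. local_cube ?n h (x[Suc k := \<not> x ! k]))"
  from h have A: "(?n, A) \<in> generated (CD_family ?n)"
  proof (rule generated_pullbackI[where \<phi> = "\<lambda>x. x[Suc k := \<not> x ! k]"], goal_cases)
    case (2 j)
    then show ?case
      using k by (intro exI[of _ "if j = Suc k then k else j"] conjI exI[of _ "j \<noteq> Suc k"]) auto
  qed (auto simp: A_def)
  \<comment> \<open>Label k + 1 is omitted, label k is full, and the former label k + 2 now stands
    between x_k and x_{k+2}. Negating x_k in \<open>\<phi>\<close> makes it (x_{k+2} or x_k), as in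
    \<open>A\<close>.\<close>
  define p where
    "p j = (if j < k then g j else if j = k then \<lambda>_ _. True
      else if j = Suc k then \<lambda>a c. c \<or> \<not> a else g (Suc j))" for j
  have "local_degenerable m p"
  proof (rule local_degenerableI)
    show "p 0 a c = p 0 b c" for a b c
      using local_degenerable_first[OF g] by (simp add: p_def)
    show "p m a b = p m a c" for a b c
      using local_degenerable_last[OF g] k by (simp add: p_def)
    show "(p j a False \<or> p (Suc j) False c) = (p j a True \<or> p (Suc j) True c)"
      if "j < m" for j a c
    proof -
      consider "Suc j < k" | "Suc j = k" | "j = k" | "j = Suc k" | "Suc k < j" by linarith
      then show ?thesis
        using local_degenerable_step[OF g, of j a c] local_degenerable_step[OF g, of "Suc j" a c] that g3
        by cases (auto simp: p_def)
    qed
    show "k \<le> m" "p k True True" using k by (auto simp: p_def)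
  qed
  then have p: "(m, local_cube m p) \<in> generated (CD_family m)" by (rule IHm)
  define \<phi> where "\<phi> x = map (\<lambda>j. x ! (if j < Suc k then j else Suc j) = (j \<noteq> k)) [0..<m]"
    for x :: "bool list"
  define B where
    "B = (\<lambda>x\<in>points ?n. (\<lambda>i. if i < Suc k then i else Suc i) ` local_cube m p (\<phi> x))"
  have B: "(?n, B) \<in> generated (CD_family ?n)"
    by (rule generated_drop_label[OF p, of "Suc k" _ "\<lambda>j. j \<noteq> k"])
      (use k in \<open>auto simp: B_def \<phi>_def\<close>)
  have \<phi>: "\<phi> x \<in> points m" for x by (simp add: \<phi>_def points_def)
  have \<phi>_nth: "\<phi> x ! j = (x ! (if j < Suc k then j else Suc j) = (j \<noteq> k))" if "j < m" for x j
    using that by (simp add: \<phi>_def)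
  have B_mem: "i \<in> B x \<longleftrightarrow>
      (if i < Suc k then i \<in> local_cube m p (\<phi> x) else i \<noteq> Suc k \<and> i - 1 \<in> local_cube m p (\<phi> x))"
    if "x \<in> points ?n" for x i
    using that by (simp only: B_def restrict_apply' mem_skip_image)
  have A_eq: "i \<in> A x \<longleftrightarrow> i \<le> ?n \<and>
      (if i = Suc k then \<not> x ! k else if i = Suc (Suc k) then x ! i \<or> x ! k
       else g i (i = 0 \<or> x ! (i - 1)) (i < ?n \<and> x ! i))"
    if "x \<in> points ?n" for x i
    using that k by (cases i) (auto simp: A_def h_def)
  have B_eq: "i \<in> B x \<longleftrightarrow> i \<le> ?n \<and>
      (if i = k then True else if i = Suc k then False else if i = Suc (Suc k) then x ! i \<or> x ! k
       else g i (i = 0 \<or> x ! (i - 1)) (i < ?n \<and> x ! i))"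
    if "x \<in> points ?n" for x i
  proof -
    consider "i < k" | "i = k" | "i = Suc k" | "i = Suc (Suc k)" | l where "i = Suc l" "Suc k < l"
      by (metis Suc_lessI Suc_less_eq2 linorder_neqE_nat)
    then show ?thesis
    proof cases
      case 1
      then show ?thesis
        using k
        by (cases i) (simp_all add: B_mem[OF that] mem_local_cube[OF \<phi>] p_def \<phi>_nth)
    next
      case 5
      then show ?thesis
        using k
        by (cases l)
          (auto simp: B_mem[OF that] mem_local_cube[OF \<phi>] p_def \<phi>_nth cong: conj_cong)
    qed (use k in \<open>simp_all add: B_mem[OF that] mem_local_cube[OF \<phi>] p_def \<phi>_nth\<close>)
  qed
  show ?thesis
  \<comment> \<open>On the common face x_k = 1 labels k, k + 1, k + 2 are 1, 0, 1. The faces x_k = 0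
    of \<open>B\<close> and \<open>A\<close> are the faces x_k = 1 and x_k = 0 of the
    target.\<close>
  proof (rule generated_glueI[OF B A, of k True], goal_cases)
    case 1
    then show ?case using k by simp
  next
    case (2 x)
    then show ?case using gk k by (intro set_eqI) (auto simp: A_eq B_eq)
  next
    case 3
    then show ?case by simp
  next
    case (4 x)
    then have "x[k := False] \<in> points ?n" by simp
    with 4 show ?case using k gk
      by (intro nat_set_eqI) (auto simp: A_eq B_eq g1 g2)
  qed
qed

section \<open>Induction on the dimension and on the number of bad positions\<close>

lemma generated_local_cube:
  assumes "local_degenerable n g"
  shows "(n, local_cube n g) \<in> generated (CD_family n)"
  using assms
proof (induction n arbitrary: g)
  case 0
  then show ?case by (intro generated_all_good) auto
next
  case (Suc m)
  note IHm = Suc.IH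
  from Suc.prems show ?case
  proof (induction "bad_count (Suc m) g" arbitrary: g rule: less_induct)
    case less
    note g = less.prems
    have IH: "\<And>h. local_degenerable (Suc m) h \<Longrightarrow> bad_count (Suc m) h < bad_count (Suc m) g \<Longrightarrow>
      (Suc m, local_cube (Suc m) h) \<in> generated (CD_family (Suc m))"
      using less.hyps by blast
    let ?idle = "\<lambda>i. (\<forall>a b c. g i a b = g i a c) \<and> (\<forall>a b c. g (Suc i) a c = g (Suc i) b c)"
    show ?case
    proof (rule ccontr)
      assume contra: "\<not> ?case"
      have nonzero: "\<exists>a c. g l a c" if "l \<le> Suc m" for l
        using generated_zero_label[OF IHm g that] contra by blast
      \<comment> \<open>The other four cases at a bad position are already settled, so what remains
        is idle, with neither label full.\<close>
      have bad: "?idle i \<and> (\<exists>a c. \<not> g i a c) \<and> (\<exists>a c. \<not> g (Suc i) a c)"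
        if "i < Suc m" "\<not> good_at g i" for i
      proof -
        have nl: "\<not> (\<forall>a c. g i a c)" and nr: "\<not> (\<forall>a c. g (Suc i) a c)"
          and nrev: "\<not> ((\<forall>a. g i a False) \<and> (\<forall>c. g (Suc i) True c))"
          using generated_left_full[OF g IH that] generated_right_full[OF g IH that]
            generated_reversed[OF g IH that] contra by blast+
        have "?idle i"
        proof (rule local_degenerable_cases[of "g i" "g (Suc i)"])
          show "(g i a False \<or> g (Suc i) False c) = (g i a True \<or> g (Suc i) True c)" for a c
            using local_degenerable_step[OF g that(1)] .
        qed (use nl nr nrev that(2) in \<open>auto simp: good_at_def\<close>)
        then show ?thesis using nl nr by blast
      qed
      obtain i where i: "i < Suc m" "\<not> good_at g i"
        using generated_all_good[OF g] contra by blast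
      note idle = bad[OF i]
      \<comment> \<open>Label 0 would ignore both its arguments, hence be constant, yet it neither
        vanishes nor is full. The same argument excludes \<open>i = m\<close> and bad neighbouring
        positions.\<close>
      have "i \<noteq> 0"
      proof
        assume "i = 0"
        then have "g 0 a c = g 0 b d" for a b c d
          using idle local_degenerable_first[OF g, of a c b] by blast
        then show False using idle nonzero[of 0] \<open>i = 0\<close> by blast
      qed
      then obtain k where ik: "i = Suc k" by (cases i) auto
      have "i \<noteq> m"
      proof
        assume "i = m"
        then have "g (Suc m) a c = g (Suc m) b d" for a b c d
          using idle local_degenerable_last[OF g, of b c d] by blast
        then show False using idle nonzero[of "Suc m"] \<open>i = m\<close> by blast
      qed
      then have "Suc k < m" using i ik by simp
      have "good_at g k"
      proof (rule ccontr)
        assume "\<not> good_at g k"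
        then have "g i a c = g i b c" for a b c using bad[of k] i ik by fastforce
        then have "g i a c = g i b d" for a b c d using idle by blast
        then show False using idle nonzero[of i] i by (meson less_imp_le)
      qed
      have "good_at g (Suc i)"
      proof (rule ccontr)
        assume "\<not> good_at g (Suc i)"
        then have "g (Suc i) a b = g (Suc i) a c" for a b c
          using bad[of "Suc i"] \<open>Suc k < m\<close> ik by fastforce
        then have "g (Suc i) a c = g (Suc i) b d" for a b c d using idle by blast
        then show False using idle nonzero[of "Suc i"] i by (meson Suc_leI)
      qed
      have "g (Suc k) False c" for c using \<open>good_at g k\<close> by (simp add: good_at_def)
      \<comment> \<open>Label i is 1 at x_{i-1} = 0, ignores x_i and is not full, so it is (not
        x_{i-1}); symmetrically, label i + 1 is x_{i+1}.\<close>
      then have g1: "g (Suc k) a c = (\<not> a)" for a c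
        using idle unfolding ik by (metis (full_types))
      have "g (Suc i) a True" for a using \<open>good_at g (Suc i)\<close> by (simp add: good_at_def)
      then have g2: "g (Suc (Suc k)) a c = c" for a c
        using idle unfolding ik by (metis (full_types))
      have ?case
      proof (rule generated_separated[OF _ _ g \<open>Suc k < m\<close> _ g1 g2])
        show "g k a True" for a using \<open>good_at g k\<close> by (simp add: good_at_def)
        show "g (Suc (Suc (Suc k))) False c" for c
          using \<open>good_at g (Suc i)\<close> by (simp add: good_at_def ik)
      qed (fact IHm IH)+
      with contra show False by contradiction
    qed
  qed
qed

section \<open>From degenerable cubes to the local description\<close>

text \<open>The points are joined through hybrids, with the first k coordinates from
  \<open>y\<close> and the rest from \<open>x\<close>; consecutive hybrids are equal or differ in
  one coordinate of \<open>J\<close>.\<close>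

lemma indep_of_outside:
  assumes indep: "\<And>j. j \<in> J \<Longrightarrow> j < n \<Longrightarrow> indep_of n j f"
    and x: "x \<in> points n" and y: "y \<in> points n"
    and eq: "\<And>j. j < n \<Longrightarrow> j \<notin> J \<Longrightarrow> x ! j = y ! j"
  shows "f x = f y"
proof -
  define z where "z k = map (\<lambda>j. if j < k then y ! j else x ! j) [0..<n]" for k
  have z: "z k \<in> points n" for k by (simp add: z_def points_def)
  have z_nth: "z k ! j = (if j < k then y ! j else x ! j)" if "j < n" for k j
    using that by (simp add: z_def)
  have z_len: "length (z k) = n" for k by (simp add: z_def)
  have "f (z k) = f x" if "k \<le> n" for k
    using that
  proof (induction k)
    case 0
    have "z 0 = x" using x by (auto simp: z_def points_def intro: nth_equalityI)
    then show ?case by simp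
  next
    case (Suc k)
    have z_Suc: "z (Suc k) = (z k)[k := y ! k]" and z_same: "(z k)[k := x ! k] = z k"
      using Suc.prems
      by (auto simp: z_nth z_len nth_list_update less_Suc_eq
          intro!: nth_equalityI split: if_splits)
    have "f (z (Suc k)) = f (z k)"
    proof (cases "k \<in> J")
      case True
      then have "f ((z k)[k := True]) = f ((z k)[k := False])"
        using indep[of k] z Suc.prems by (auto simp: indep_of_def)
      then have "f ((z k)[k := b]) = f ((z k)[k := c])" for b c by (cases b; cases c) auto
      then show ?thesis using z_Suc z_same by metis
    next
      case False
      then show ?thesis using eq[of k] Suc.prems z_Suc z_same by simp
    qed
    then show ?case using Suc by simp
  qed
  moreover have "z n = y" using y by (auto simp: z_def points_def intro: nth_equalityI)
  ultimately show ?thesis by force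
qed

theorem mainTheorem3:
  fixes n :: nat and X :: fcube
  assumes "n \<ge> 1"
    and "X \<in> formal_cubes n n"
    and "degenerable n X"
  shows "(n, X) \<in> generated (CD_family n)"
proof -
  \<comment> \<open>A sample point with x_{i-1} = a, x_i = c and zeros elsewhere; at the two ends
    the argument without a coordinate is ignored.\<close>
  define pt where "pt i a c = map (\<lambda>j. if j = i then c else Suc j = i \<and> a) [0..<n]" for i a c
  define g where "g i a c \<longleftrightarrow> i \<in> X (pt i a c)" for i a c
  have pt: "pt i a c \<in> points n" for i a c by (simp add: pt_def points_def)
  have pt_nth: "pt i a c ! j = (if j = i then c else Suc j = i \<and> a)" if "j < n" for i a c j
    using that by (simp add: pt_def)
  have X: "X x \<subseteq> {..n}" "X x \<noteq> {}" if "x \<in> points n" for x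
    using assms(2) that by (fastforce simp: formal_cubes_def Sub_def PiE_iff)+
  have label: "(i \<in> X x) = (i \<in> X y)"
    if "x \<in> points n" "y \<in> points n" "i \<le> n" "\<And>j. j < n \<Longrightarrow> j = i \<or> Suc j = i \<Longrightarrow> x ! j = y ! j"
    for x y i
    using indep_of_outside[of "{j. j \<noteq> i \<and> Suc j \<noteq> i}" n "label_fun X i" x y] assms(3) that
    by (auto simp: degenerable_def label_fun_def)
  have join: "(i \<in> X (x[i := True]) \<or> Suc i \<in> X (x[i := True])) =
      (i \<in> X (x[i := False]) \<or> Suc i \<in> X (x[i := False]))"
    if "x \<in> points n" "i < n" for x i
    using assms(3) that by (auto simp: degenerable_def label_fun_def indep_of_def)
  have g_eq: "g i a c \<longleftrightarrow> i \<in> X x"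
    if "x \<in> points n" "i \<le> n" "i < n \<Longrightarrow> x ! i = c" "i > 0 \<Longrightarrow> x ! (i - 1) = a" for x i a c
    unfolding g_def by (rule label[OF pt that(1,2)]) (use that in \<open>auto simp: pt_nth\<close>)
  have "local_degenerable n g"
  proof (rule local_degenerableI)
    show "g 0 a c = g 0 b c" for a b c by (rule g_eq[THEN trans, OF pt _ _ _ g_def[symmetric]])
        (use assms(1) in \<open>auto simp: pt_nth\<close>)
    show "g n a b = g n a c" for a b c by (rule g_eq[THEN trans, OF pt _ _ _ g_def[symmetric]])
        (use assms(1) in \<open>auto simp: pt_nth\<close>)
    show "(g i a False \<or> g (Suc i) False c) = (g i a True \<or> g (Suc i) True c)"
      if "i < n" for i a c
    proof -
      \<comment> \<open>One point with x_{i-1} = a and x_{i+1} = c, so that updating x_i realises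
        both labels at once.\<close>
      define x where "x = map (\<lambda>j. if j = Suc i then c else a) [0..<n]"
      have x: "x \<in> points n" by (simp add: x_def points_def)
      have x_nth: "x ! j = (if j = Suc i then c else a)" if "j < n" for j
        using that by (simp add: x_def)
      have "g i a b = (i \<in> X (x[i := b]))" "g (Suc i) b c = (Suc i \<in> X (x[i := b]))" for b
        by (rule g_eq; use x that in \<open>auto simp: x_nth\<close>)+
      then show ?thesis using join[OF x that] by simp
    qed
    have x: "replicate n False \<in> points n" by (simp add: points_def)
    from X[OF this] have "(SOME i. i \<in> X (replicate n False)) \<in> X (replicate n False)"
      by (simp add: some_in_eq)
    then show "(SOME i. i \<in> X (replicate n False)) \<le> n"
      and "g (SOME i. i \<in> X (replicate n False)) False False"
      using X(1)[OF x] g_eq[OF x] by auto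
  qed
  moreover have "local_cube n g = X"
  proof (rule extensionalityI[OF local_cube_ext])
    show "X \<in> extensional (points n)" using assms(2) by (simp add: formal_cubes_def PiE_iff)
    show "local_cube n g x = X x" if "x \<in> points n" for x
    proof (rule set_eqI)
      fix i
      have "i \<in> X x \<Longrightarrow> i \<le> n" using X(1)[OF that] by auto
      then show "i \<in> local_cube n g x \<longleftrightarrow> i \<in> X x"
        using g_eq[OF that, of i "x ! i" ] g_eq[OF that, of i "i < n \<and> x ! i" "i = 0 \<or> x ! (i - 1)"]
        by (auto simp: mem_local_cube[OF that])
    qed
  qed
  ultimately show ?thesis using generated_local_cube by metis
qed

end
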